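(* For all $n,q \in \mathbb{Z}^+$, $$ f(n,q) \leq {}^{n-1}(2q+1). $$
   Context: A word is a finite string of letters; a word is $q$-ary if at most $q$ distinct letters occur in it. A factor of a word is a string of consecutive letters of it. A homomorphism between free monoids is nonerasing if no letter is mapped to the empty word $\varepsilon$. A word $U$ is an instance of a word $V$ (a $V$-instance) if $U=\phi(V)$ for some nonerasing homomorphism $\phi$. A word $W$ encounters $V$ if some factor of $W$ is a $V$-instance. The Zimin words are defined by $Z_0=\varepsilon$ and $Z_{n+1}=Z_n x_n Z_n$, where $x_0,x_1,x_2,\dots$ are distinct letters (so $Z_1=a$, $Z_2=aba$, $Z_3=abacaba$, ...). $f(n,q)$ is the least integer $M$ such that every $q$-ary word of length $M$ encounters $Z_n$. The tetration ${}^{b}a$ denotes the tower $a^{a^{\cdot^{\cdot^{a}}}}$ with $b$ occurrences of $a$, i.e. ${}^{0}a=1$ and ${}^{b+1}a=a^{({}^{b}a)}$. *)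

theory Defs
  imports Main "HOL-Library.Sublist" "HOL-Library.Extended_Nat"
begin

definition q_ary :: "nat \<Rightarrow> 'a list \<Rightarrow> bool" where
  "q_ary q w \<longleftrightarrow> card (set w) \<le> q"

definition nonerasing_hom :: "('a list \<Rightarrow> 'b list) \<Rightarrow> bool" where
  "nonerasing_hom \<phi> \<longleftrightarrow>
     \<phi> [] = [] \<and> (\<forall>u v. \<phi> (u @ v) = \<phi> u @ \<phi> v) \<and> (\<forall>x. \<phi> [x] \<noteq> [])"

definition instance_of :: "'b list \<Rightarrow> 'a list \<Rightarrow> bool" where
  "instance_of U V \<longleftrightarrow> (\<exists>\<phi>. nonerasing_hom \<phi> \<and> U = \<phi> V)"

(* The library's sublist is the contiguous one, i.e. the factor relation. *)
definition encounters :: "'b list \<Rightarrow> 'a list \<Rightarrow> bool" where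
  "encounters W V \<longleftrightarrow> (\<exists>U. sublist U W \<and> instance_of U V)"

(* The letter x_n is the natural number n. *)
primrec zimin :: "nat \<Rightarrow> nat list" where
  "zimin 0 = []"
| "zimin (Suc n) = zimin n @ [n] @ zimin n"

(* Words range over the infinite alphabet nat. This loses no generality, because only
   finitely many letters occur in a word and encountering is invariant under renaming them.
   The infimum in enat is the least such M, and is infinite if there is none: an upper
   bound on zimin_f n q therefore includes the existence of M. *)
definition zimin_f :: "nat \<Rightarrow> nat \<Rightarrow> enat" where
  "zimin_f n q =
     (INF M \<in> {M. \<forall>w :: nat list. q_ary q w \<and> length w = M \<longrightarrow> encounters w (zimin n)}. enat M)"

(* tetration a b is the tower with b occurrences of a. *)
primrec tetration :: "nat \<Rightarrow> nat \<Rightarrow> nat" where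
  "tetration a 0 = 1"
| "tetration a (Suc b) = a ^ tetration a b"

end

theory Submission
  imports Defs
begin

text \<open>
  The bound is a tower because one more Zimin letter costs one exponential. Suppose that every
  \<open>q\<close>-ary word of length \<open>T\<close> encounters the \<open>n\<close>-th Zimin word \<open>Z\<close>. Cut a long \<open>q\<close>-ary word into
  \<open>q ^ T + 1\<close> blocks of length \<open>T\<close>, leaving one letter between consecutive blocks. Two of these
  blocks are equal, and the common block contains an instance \<open>U\<close> of \<open>Z\<close>. So \<open>U\<close> occurs twice, with
  at least the separating letter in between; the nonempty gap can serve as the image of the new
  letter \<open>n\<close>, and the word encounters the next Zimin word
  (\<open>block_repetition\<close>, \<open>encounters_zimin_Suc\<close>).

  The blocks and separators need \<open>(T + 1) * (q ^ T + 1) - 1 = T * q ^ T + q ^ T + T\<close> letters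
  (\<open>zimin_unavoidable_step\<close>). For positive \<open>q\<close> and \<open>T\<close>, this is at most the sum of the two leading
  terms of the binomial expansion of \<open>(q + (q + 1)) ^ T\<close>, so \<open>(2 * q + 1) ^ T\<close> letters suffice,
  which is the recursion of the tetration.
\<close>

definition zimin_unavoidable :: "nat \<Rightarrow> nat \<Rightarrow> nat \<Rightarrow> bool" where
  "zimin_unavoidable n q M \<longleftrightarrow>
     (\<forall>w :: nat list. q_ary q w \<and> length w = M \<longrightarrow> encounters w (zimin n))"

lemma set_zimin: "set (zimin n) \<subseteq> {..<n}"
  by (induction n) auto

lemma nonerasing_hom_conv_concat:
  assumes "nonerasing_hom \<phi>"
  shows "\<phi> u = concat (map (\<lambda>x. \<phi> [x]) u)"
proof (induction u)
  case Nil
  then show ?case using assms by (simp add: nonerasing_hom_def)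
next
  case (Cons a u)
  have "\<phi> ([a] @ u) = \<phi> [a] @ \<phi> u" using assms unfolding nonerasing_hom_def by blast
  then show ?case using Cons by simp
qed

lemma nonerasing_hom_concat_map:
  assumes "\<And>x. f x \<noteq> []"
  shows "nonerasing_hom (\<lambda>u. concat (map f u))"
  using assms by (simp add: nonerasing_hom_def)

text \<open>Since the letter \<open>n\<close> does not occur in \<open>zimin n\<close>, its image can be chosen freely without
  affecting the images of the two copies of \<open>zimin n\<close>.\<close>

lemma instance_of_zimin_Suc:
  assumes "instance_of U (zimin n)" and "x \<noteq> []"
  shows "instance_of (U @ x @ U) (zimin (Suc n))"
proof -
  obtain \<phi> where \<phi>: "nonerasing_hom \<phi>" "U = \<phi> (zimin n)"
    using assms(1) unfolding instance_of_def by blast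
  define f where "f = (\<lambda>i. if i = n then x else \<phi> [i])"
  have "map f (zimin n) = map (\<lambda>i. \<phi> [i]) (zimin n)"
    using set_zimin[of n] by (auto simp: f_def)
  then have "concat (map f (zimin n)) = U"
    using nonerasing_hom_conv_concat[OF \<phi>(1), of "zimin n"] \<phi>(2) by (simp only:)
  then have "U @ x @ U = concat (map f (zimin (Suc n)))"
    by (simp add: f_def)
  moreover have "nonerasing_hom (\<lambda>u. concat (map f u))"
    using \<phi>(1) assms(2) by (intro nonerasing_hom_concat_map) (auto simp: f_def nonerasing_hom_def)
  ultimately show ?thesis unfolding instance_of_def by blast
qed

text \<open>If \<open>B = p @ U @ s\<close> with an instance \<open>U\<close> of \<open>zimin n\<close>, then the two copies of \<open>U\<close> in
  \<open>B @ y @ B\<close> are separated by \<open>s @ y @ p\<close>. The word \<open>y\<close> must be nonempty, as \<open>s\<close> and \<open>p\<close> may both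
  be empty.\<close>

lemma encounters_zimin_Suc:
  assumes "encounters B (zimin n)" and "y \<noteq> []"
  shows "encounters (pre @ B @ y @ B @ post) (zimin (Suc n))"
proof -
  obtain p U s where B: "B = p @ U @ s" and U: "instance_of U (zimin n)"
    using assms(1) unfolding encounters_def sublist_def by blast
  have "pre @ B @ y @ B @ post = (pre @ p) @ (U @ (s @ y @ p) @ U) @ (s @ post)"
    by (simp add: B)
  moreover have "instance_of (U @ (s @ y @ p) @ U) (zimin (Suc n))"
    using U assms(2) by (intro instance_of_zimin_Suc) auto
  ultimately show ?thesis unfolding encounters_def sublist_def by blast
qed

text \<open>There are at most \<open>q ^ T\<close> words of length \<open>T\<close> over the letters of \<open>w\<close>, so two of the
  \<open>q ^ T + 1\<close> blocks that start at the multiples of \<open>T + 1\<close> agree. The last block needs no letter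
  after it, which is why \<open>length w + 1\<close> appears in the bound.\<close>

lemma block_repetition:
  assumes q: "q_ary q w" and len: "(T + 1) * (q ^ T + 1) \<le> length w + 1"
  obtains pre B y post where "w = pre @ B @ y @ B @ post" "length B = T" "y \<noteq> []"
proof -
  define block where "block i = take T (drop (i * (T + 1)) w)" for i
  have fits: "i * (T + 1) + T \<le> length w" if "i \<le> q ^ T" for i
  proof -
    have "i * (T + 1) \<le> q ^ T * (T + 1)" using that by (rule mult_le_mono1)
    then show ?thesis using len by (simp add: algebra_simps)
  qed
  have length_block: "length (block i) = T" if "i \<le> q ^ T" for i
    using fits[OF that] by (simp add: block_def)
  define words where "words = {u. set u \<subseteq> set w \<and> length u = T}"
  have "block ` {..q ^ T} \<subseteq> words"
    using length_block unfolding words_def block_def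
    by (auto dest: in_set_takeD in_set_dropD)
  moreover have "finite words" unfolding words_def by (simp add: finite_lists_length_eq)
  moreover have "card words \<le> q ^ T"
    using q unfolding words_def q_ary_def by (simp add: card_lists_length_eq power_mono)
  ultimately have "card (block ` {..q ^ T}) < card {..q ^ T}"
    using card_mono[of words "block ` {..q ^ T}"] by simp
  then have "\<not> inj_on block {..q ^ T}" by (rule pigeonhole)
  then obtain i j where ij: "i < j" "j \<le> q ^ T" "block i = block j"
    unfolding inj_on_def by (metis atMost_iff linorder_neqE_nat)
  define a b where "a = i * (T + 1)" and "b = j * (T + 1)"
  have "Suc i * (T + 1) \<le> j * (T + 1)" using ij(1) by (intro mult_le_mono1) simp
  then have ab: "a + T + 1 \<le> b" by (simp add: a_def b_def)
  have b: "b + T \<le> length w" using fits[OF ij(2)] by (simp add: b_def)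
  define y where "y = take (b - (a + T)) (drop (a + T) w)"
  have "w = take a w @ take T (drop a w) @ drop (a + T) w"
    by (metis append_take_drop_id drop_drop add.commute)
  also have "drop (a + T) w = y @ drop b w"
    using ab by (metis y_def append_take_drop_id drop_drop le_add_diff_inverse2 add_leD1)
  also have "drop b w = take T (drop b w) @ drop (b + T) w"
    by (metis append_take_drop_id drop_drop add.commute)
  finally have "w = take a w @ block j @ y @ block j @ drop (b + T) w"
    using ij(3) by (simp add: block_def a_def b_def)
  moreover have "y \<noteq> []" using ab b by (simp add: y_def)
  ultimately show ?thesis using that length_block[OF ij(2)] by blast
qed

lemma zimin_unavoidable_step:
  assumes "zimin_unavoidable n q T" and "(T + 1) * (q ^ T + 1) \<le> M + 1"
  shows "zimin_unavoidable (Suc n) q M"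
  unfolding zimin_unavoidable_def
proof (intro allI impI)
  fix w :: "nat list"
  assume w: "q_ary q w \<and> length w = M"
  then obtain pre B y post where split: "w = pre @ B @ y @ B @ post" "length B = T" "y \<noteq> []"
    using block_repetition[of q w T] assms(2) by blast
  have "card (set B) \<le> card (set w)" by (intro card_mono) (auto simp: split(1))
  then have "q_ary q B" using w by (simp add: q_ary_def)
  then have "encounters B (zimin n)"
    using assms(1) split(2) unfolding zimin_unavoidable_def by blast
  then show "encounters w (zimin (Suc n))"
    unfolding split(1) using split(3) by (rule encounters_zimin_Suc)
qed

text \<open>The first two terms of the binomial expansion, with \<open>Suc t\<close> as the exponent to avoid
  subtraction.\<close>

lemma power_add_ge_two_terms:
  fixes a b :: nat
  shows "a ^ Suc t + Suc t * (a ^ t * b) \<le> (a + b) ^ Suc t"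
proof (induction t)
  case 0
  then show ?case by simp
next
  case (Suc t)
  have "a ^ Suc (Suc t) + Suc (Suc t) * (a ^ Suc t * b)
      \<le> (a + b) * (a ^ Suc t + Suc t * (a ^ t * b))"
    by (simp add: algebra_simps)
  also have "\<dots> \<le> (a + b) * (a + b) ^ Suc t" using Suc by (rule mult_le_mono2)
  finally show ?case by simp
qed

lemma block_length_le_power:
  fixes q T :: nat
  assumes "q > 0" and "T > 0"
  shows "(T + 1) * (q ^ T + 1) \<le> (2 * q + 1) ^ T + 1"
proof -
  obtain t where T: "T = Suc t" using assms(2) gr0_implies_Suc by blast
  have "1 \<le> q ^ t" using assms(1) by simp
  then have "T * 1 \<le> T * q ^ t" by (rule mult_le_mono2)
  then have "(T + 1) * (q ^ T + 1) \<le> q ^ T + T * (q ^ t * (q + 1)) + 1"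
    by (simp add: T algebra_simps)
  also have "\<dots> \<le> (q + (q + 1)) ^ T + 1"
    using power_add_ge_two_terms[of q t "q + 1"] by (simp add: T)
  also have "q + (q + 1) = 2 * q + 1" by simp
  finally show ?thesis .
qed

lemma zimin_unavoidable_tetration:
  assumes "q > 0"
  shows "zimin_unavoidable (Suc m) q (tetration (2 * q + 1) m)"
proof (induction m)
  case 0
  have "nonerasing_hom (\<lambda>u :: nat list. u)" by (simp add: nonerasing_hom_def)
  then have "instance_of ([] :: nat list) (zimin 0)" unfolding instance_of_def by auto
  then have "zimin_unavoidable 0 q 0"
    unfolding zimin_unavoidable_def encounters_def by blast
  \<comment> \<open>With \<open>T = 0\<close>, the construction uses two empty blocks around a single letter.\<close>
  then show ?case by (rule zimin_unavoidable_step) simp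
next
  case (Suc m)
  have "tetration (2 * q + 1) m > 0" by (cases m) simp_all
  then show ?case
    using zimin_unavoidable_step[OF Suc block_length_le_power[OF assms]] by simp
qed

theorem theorem2p2:
  fixes n q :: nat
  assumes "n > 0" and "q > 0"
  shows "zimin_f n q \<le> enat (tetration (2 * q + 1) (n - 1))"
proof -
  have "zimin_unavoidable n q (tetration (2 * q + 1) (n - 1))"
    using zimin_unavoidable_tetration[OF assms(2), of "n - 1"] assms(1) by simp
  then show ?thesis
    unfolding zimin_f_def zimin_unavoidable_def by (intro INF_lower) simp
qed

end
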